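(* Let $d\in\mathbb N$, $d\ge 1$, $m\in\mathbb N$, $p\in\mathbb N$, let $T\subset\mathbb R^d$ be a mesh element (an open, bounded, connected, Lipschitz polytope) with diameter $h_T$, and let $\mathbf x_T\in T$. Let $\mathcal M=\sum_{|\boldsymbol j|\le m}\alpha_{\boldsymbol j}D^{\boldsymbol j}$ be a linear partial differential operator of order $m$ with $\alpha_{\boldsymbol j}\in C^{\max\{p-m,0\}}(T)$ for all $|\boldsymbol j|\le m$, and let $u\in C^{p+1}(T)$ satisfy $\mathcal M u=0$ in $T$. Then the Taylor polynomial $\mathsf T^{p+1}_T[u]$ of $u$ centred at $\mathbf x_T$ belongs to the quasi-Trefftz space $\mathbb{QT}^p(T)$. Moreover, if $T$ is star-shaped with respect to $\mathbf x_T$, then for all $q\in\mathbb N$ with $q\le p$, $$\inf_{v\in\mathbb{QT}^p(T)}|u-v|_{C^q(T)}\le \frac{d^{\,p+1-q}}{(p+1-q)!}\,h_T^{\,p+1-q}\,|u|_{C^{p+1}(T)}.$$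
   Context: $\mathbb N=\{0,1,2,\dots\}$. For multi-indices $\boldsymbol i\in\mathbb N^d$: $|\boldsymbol i|=i_1+\dots+i_d$, $\boldsymbol i!=i_1!\cdots i_d!$, $D^{\boldsymbol i}=\partial_{x_1}^{i_1}\cdots\partial_{x_d}^{i_d}$, $\mathbf x^{\boldsymbol i}=x_1^{i_1}\cdots x_d^{i_d}$. $\mathbb P^p_d(T)$ is the space of polynomials of total degree at most $p$ in $d$ variables on $T$. Taylor polynomial of order $p+1$ (degree at most $p$) centred at $\mathbf x_T$: $\mathsf T^{p+1}_T[v](\mathbf x)=\sum_{|\boldsymbol j|\le p}\frac1{\boldsymbol j!}D^{\boldsymbol j}v(\mathbf x_T)(\mathbf x-\mathbf x_T)^{\boldsymbol j}$. Local quasi-Trefftz space for $\mathcal M u=0$: $$\mathbb{QT}^p(T)=\{v\in\mathbb P^p_d(T)\mid D^{\boldsymbol i}(\mathcal M v)(\mathbf x_T)=0\ \ \forall \boldsymbol i\in\mathbb N^d,\ |\boldsymbol i|\le p-m\}$$ (so $\mathbb{QT}^p(T)=\mathbb P^p_d(T)$ if $p<m$). Norms: $\|v\|_{C^0(T)}=\sup_{\mathbf x\in T}|v(\mathbf x)|$ and $|v|_{C^k(T)}=\max_{|\boldsymbol i|=k}\|D^{\boldsymbol i}v\|_{C^0(T)}$. The diameter is $h_T=\sup_{\mathbf x,\mathbf y\in T}|\mathbf x-\mathbf y|$. *)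

theory Defs
  imports "HOL-Analysis.Analysis"
begin

type_synonym 'n mindex = "'n \<Rightarrow> nat"

definition mi_abs :: "('n::finite) mindex \<Rightarrow> nat"
  where "mi_abs i = (\<Sum>k\<in>UNIV. i k)"

definition mi_fact :: "('n::finite) mindex \<Rightarrow> real"
  where "mi_fact i = (\<Prod>k\<in>UNIV. fact (i k))"

definition monomial :: "('n::finite) mindex \<Rightarrow> real ^ 'n \<Rightarrow> real"
  where "monomial i x = (\<Prod>k\<in>UNIV. (x $ k) ^ i k)"

text \<open>The sums and maxima below range over finite nonempty sets of multi-indices, so no default
  value of \<^const>\<open>sum\<close> or \<^const>\<open>Max\<close> is involved.\<close>

lemma finite_mi_le: "finite {i :: ('n::finite) mindex. mi_abs i \<le> p}"
proof (rule finite_subset)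
  show "{i :: 'n mindex. mi_abs i \<le> p} \<subseteq> PiE UNIV (\<lambda>_. {..p})"
  proof
    fix i :: "'n mindex" assume i: "i \<in> {i. mi_abs i \<le> p}"
    have "i k \<le> p" for k
    proof -
      have "i k \<le> sum i UNIV" by (rule member_le_sum) simp_all
      with i show ?thesis by (simp add: mi_abs_def)
    qed
    then show "i \<in> PiE UNIV (\<lambda>_. {..p})" by (simp add: PiE_UNIV_domain)
  qed
qed (simp add: finite_PiE)

lemma finite_mi_eq: "finite {i :: ('n::finite) mindex. mi_abs i = p}"
  by (rule finite_subset[OF _ finite_mi_le[of p]]) auto

lemma mi_eq_nonempty: "{i :: ('n::finite) mindex. mi_abs i = p} \<noteq> {}"
proof -
  have "mi_abs (\<lambda>k :: 'n. if k = undefined then p else 0) = p"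
    by (simp add: mi_abs_def)
  then show ?thesis by blast
qed

definition partial_deriv :: "'n \<Rightarrow> (real ^ ('n::finite) \<Rightarrow> real) \<Rightarrow> real ^ 'n \<Rightarrow> real"
  where "partial_deriv k f x = deriv (\<lambda>t. f (x + t *\<^sub>R axis k 1)) 0"

text \<open>An index type of class \<^class>\<open>finite\<close> carries no order, so the order in which the
  coordinates \<open>x\<^sub>1, \<dots>, x\<^sub>d\<close> are differentiated is fixed by an arbitrary enumeration. By the
  symmetry of mixed derivatives the choice is irrelevant for functions of class \<open>C\<close> to the
  order of the derivative.\<close>

definition coords :: "('n::finite) list"
  where "coords = (SOME ks. distinct ks \<and> set ks = UNIV)"

lemma distinct_coords: "distinct (coords :: ('n::finite) list)"
  and set_coords: "set (coords :: ('n::finite) list) = UNIV"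
proof -
  have "\<exists>ks :: 'n list. distinct ks \<and> set ks = UNIV"
    using finite_distinct_list[of "UNIV :: 'n set"] by auto
  then have "distinct (coords :: 'n list) \<and> set (coords :: 'n list) = UNIV"
    unfolding coords_def by (rule someI_ex)
  then show "distinct (coords :: 'n list)" "set (coords :: 'n list) = UNIV" by auto
qed

definition mderiv :: "('n::finite) mindex \<Rightarrow> (real ^ 'n \<Rightarrow> real) \<Rightarrow> real ^ 'n \<Rightarrow> real"
  where "mderiv i f = foldr (\<lambda>k g. (partial_deriv k ^^ i k) g) coords f"

text \<open>\<open>k\<close> times continuously differentiable functions on an open set \<open>S\<close>; functions are total,
  but for open \<open>S\<close> only the values on \<open>S\<close> matter. No boundedness of the derivatives and no
  continuous extension to the closure of \<open>S\<close> is required.\<close>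

primrec C_class :: "nat \<Rightarrow> (real ^ ('n::finite)) set \<Rightarrow> (real ^ 'n \<Rightarrow> real) \<Rightarrow> bool" where
  "C_class 0 S f \<longleftrightarrow> continuous_on S f"
| "C_class (Suc k) S f \<longleftrightarrow> continuous_on S f \<and>
     (\<forall>a. (\<forall>x\<in>S. (\<lambda>t. f (x + t *\<^sub>R axis a 1)) differentiable (at 0)) \<and>
          C_class k S (partial_deriv a f))"

text \<open>The norms take values in \<^typ>\<open>ennreal\<close>, since the derivatives of a function that is
  smooth on a bounded open set may be unbounded.\<close>

definition C0_norm :: "(real ^ ('n::finite)) set \<Rightarrow> (real ^ 'n \<Rightarrow> real) \<Rightarrow> ennreal"
  where "C0_norm T v = (SUP x\<in>T. ennreal \<bar>v x\<bar>)"

definition C_seminorm :: "nat \<Rightarrow> (real ^ ('n::finite)) set \<Rightarrow> (real ^ 'n \<Rightarrow> real) \<Rightarrow> ennreal"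
  where "C_seminorm k T v = (MAX i\<in>{i. mi_abs i = k}. C0_norm T (mderiv i v))"

text \<open>Polynomials are represented by functions on the whole space. On a nonempty open set a
  polynomial function is determined by its restriction, so this is the same space.\<close>

definition poly_space :: "nat \<Rightarrow> (real ^ ('n::finite) \<Rightarrow> real) set"
  where "poly_space p = {v. \<exists>c. v = (\<lambda>x. \<Sum>i | mi_abs i \<le> p. c i * monomial i x)}"

text \<open>The Taylor polynomial of order \<open>n\<close> has degree less than \<open>n\<close>.\<close>

definition taylor_poly ::
    "nat \<Rightarrow> real ^ ('n::finite) \<Rightarrow> (real ^ 'n \<Rightarrow> real) \<Rightarrow> real ^ 'n \<Rightarrow> real"
  where "taylor_poly n a v x =
    (\<Sum>j | mi_abs j < n. 1 / mi_fact j * mderiv j v a * monomial j (x - a))"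

definition diff_op ::
    "nat \<Rightarrow> (('n::finite) mindex \<Rightarrow> real ^ 'n \<Rightarrow> real) \<Rightarrow> (real ^ 'n \<Rightarrow> real) \<Rightarrow> real ^ 'n \<Rightarrow> real"
  where "diff_op m \<alpha> v x = (\<Sum>j | mi_abs j \<le> m. \<alpha> j x * mderiv j v x)"

text \<open>The condition \<open>|i| \<le> p - m\<close> is an inequality between integers, hence void for \<open>p < m\<close>;
  it is written without the truncated subtraction on \<^typ>\<open>nat\<close>.\<close>

definition quasi_trefftz ::
    "nat \<Rightarrow> nat \<Rightarrow> (('n::finite) mindex \<Rightarrow> real ^ 'n \<Rightarrow> real) \<Rightarrow> real ^ 'n \<Rightarrow> (real ^ 'n \<Rightarrow> real) set"
  where "quasi_trefftz p m \<alpha> a =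
    {v \<in> poly_space p. \<forall>i. mi_abs i + m \<le> p \<longrightarrow> mderiv i (diff_op m \<alpha> v) a = 0}"

text \<open>Near every boundary point the domain is, in suitable orthonormal coordinates, the strict
  epigraph of a Lipschitz function on a hyperplane. The last coordinate is \<open>y \<bullet> e\<close>, and
  \<open>y - (y \<bullet> e) *\<^sub>R e\<close> is the projection to the hyperplane orthogonal to the unit vector \<open>e\<close>.\<close>

definition lipschitz_domain :: "'a::euclidean_space set \<Rightarrow> bool"
  where "lipschitz_domain T \<longleftrightarrow>
    (\<forall>x\<in>frontier T. \<exists>e r L. \<exists>\<phi> :: 'a \<Rightarrow> real.
       norm e = 1 \<and> 0 < r \<and> L-lipschitz_on {z. z \<bullet> e = 0} \<phi> \<and>
       T \<inter> ball x r = {y \<in> ball x r. \<phi> (y - (y \<bullet> e) *\<^sub>R e) < y \<bullet> e})"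

text \<open>Mesh elements need not be convex, whereas \<^const>\<open>polytope\<close> denotes a convex hull of
  finitely many points; a general polytope is a finite union of such sets.\<close>

definition mesh_element :: "'a::euclidean_space set \<Rightarrow> bool"
  where "mesh_element T \<longleftrightarrow> open T \<and> bounded T \<and> connected T \<and> lipschitz_domain T \<and>
    (\<exists>F. finite F \<and> (\<forall>P\<in>F. polytope P) \<and> closure T = \<Union>F)"

definition star_shaped_wrt :: "'a::real_vector \<Rightarrow> 'a set \<Rightarrow> bool"
  where "star_shaped_wrt a T \<longleftrightarrow> (\<forall>x\<in>T. closed_segment a x \<subseteq> T)"

end

theory Submission
  imports Defs
begin

text \<open>The Taylor polynomial \<open>P\<close> of \<open>u\<close> has the same derivatives as \<open>u\<close> at the centre up to order
  \<open>p\<close>. Hence \<open>\<M> P = \<M> (P - u)\<close> is a sum of products \<open>\<alpha>\<^sub>j D\<^sup>j (P - u)\<close> whose second factors vanish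
  at the centre to order \<open>p - m\<close>; by the product rule so do the products, and \<open>P\<close> is quasi-Trefftz.
  For the estimate take \<open>v = P\<close>: the function \<open>g = D\<^sup>i (u - P)\<close> with \<open>|i| = q\<close> vanishes at the centre
  to order \<open>p - q\<close>, so the one-dimensional Taylor formula on the segment from the centre to \<open>x\<close>
  leaves only the remainder of order \<open>n = p + 1 - q\<close>. This is a sum of \<open>d\<^sup>n\<close> terms, each a product
  of \<open>n\<close> components of \<open>x - x\<^sub>T\<close> with a derivative of \<open>u\<close> of order \<open>p + 1\<close>, as those of \<open>P\<close> vanish.\<close>

subsection \<open>Functions of class \<open>C\<^sup>k\<close>\<close>

lemma partial_deriv_DERIV:
  assumes "(\<lambda>t. f (x + t *\<^sub>R axis a 1)) differentiable (at 0)"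
  shows "((\<lambda>t. f (x + t *\<^sub>R axis a 1)) has_real_derivative partial_deriv a f x) (at 0)"
  using assms unfolding partial_deriv_def by (simp add: DERIV_deriv_iff_real_differentiable)

lemma partial_derivI:
  assumes "((\<lambda>t. f (x + t *\<^sub>R axis a 1)) has_real_derivative D) (at 0)"
  shows "partial_deriv a f x = D"
  using assms unfolding partial_deriv_def by (rule DERIV_imp_deriv)

text \<open>By continuity of the line. It makes everything below local: functions are total, and
  agreement on an open set has to suffice for equal derivatives there.\<close>

lemma eventually_line:
  assumes "open S" "x \<in> S"
  shows "\<forall>\<^sub>F t in nhds (0::real). x + t *\<^sub>R axis a (1::real) \<in> S"
proof -
  have "((\<lambda>t. x + t *\<^sub>R axis a (1::real)) \<longlongrightarrow> x + 0 *\<^sub>R axis a 1) (nhds (0::real))"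
    by (intro tendsto_intros filterlim_ident)
  then show ?thesis using assms topological_tendstoD[of _ x] by fastforce
qed

lemma line_cong:
  assumes "open S" "x \<in> S" "\<And>y. y \<in> S \<Longrightarrow> f y = g y"
  shows "\<forall>\<^sub>F t in nhds (0::real). f (x + t *\<^sub>R axis a 1) = g (x + t *\<^sub>R axis a (1::real))"
  using eventually_line[OF assms(1,2)] by eventually_elim (use assms(3) in auto)

lemma partial_deriv_cong:
  assumes "open S" "x \<in> S" "\<And>y. y \<in> S \<Longrightarrow> f y = g y"
  shows "partial_deriv a f x = partial_deriv a g x"
  unfolding partial_deriv_def by (rule deriv_cong_ev[OF line_cong[OF assms] refl])

lemma line_differentiable_cong:
  fixes f g :: "real ^ 'n \<Rightarrow> real"
  assumes "open S" "x \<in> S" "\<And>y. y \<in> S \<Longrightarrow> f y = g y"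
    and "(\<lambda>t. f (x + t *\<^sub>R axis a 1)) differentiable (at 0)"
  shows "(\<lambda>t. g (x + t *\<^sub>R axis a 1)) differentiable (at 0)"
proof -
  have "((\<lambda>t. f (x + t *\<^sub>R axis a 1)) has_real_derivative D) (at 0) \<longleftrightarrow>
      ((\<lambda>t. g (x + t *\<^sub>R axis a 1)) has_real_derivative D) (at 0)" for D
    by (rule DERIV_cong_ev[OF refl line_cong[OF assms(1-3)] refl])
  then show ?thesis using assms(4) by (auto simp: real_differentiable_def)
qed

lemma C_class_imp_continuous: "C_class k S f \<Longrightarrow> continuous_on S f"
  by (cases k) auto

lemma C_class_Suc_D: "C_class (Suc k) S f \<Longrightarrow> C_class k S f"
proof (induction k arbitrary: f)
  case (Suc k)
  then show ?case using C_class.simps(2) by metis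
qed simp

lemma C_class_mono: "k \<le> l \<Longrightarrow> C_class l S f \<Longrightarrow> C_class k S f"
  by (induction l rule: dec_induct) (auto dest: C_class_Suc_D simp del: C_class.simps)

lemma C_class_partial_deriv: "C_class (Suc k) S f \<Longrightarrow> C_class k S (partial_deriv a f)"
  by simp

lemma C_class_DERIV:
  "C_class (Suc k) S f \<Longrightarrow> x \<in> S \<Longrightarrow>
    ((\<lambda>t. f (x + t *\<^sub>R axis a 1)) has_real_derivative partial_deriv a f x) (at 0)"
  by (intro partial_deriv_DERIV) simp

text \<open>Any point of the line may serve as base point, so the derivative at 0 there becomes a
  derivative at \<open>t\<close>. This is the form that mean value arguments use.\<close>

lemma C_class_DERIV_line:
  assumes "C_class (Suc k) S f" "x + t *\<^sub>R axis a 1 \<in> S"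
  shows "((\<lambda>t. f (x + t *\<^sub>R axis a 1)) has_real_derivative
    partial_deriv a f (x + t *\<^sub>R axis a 1)) (at t)"
  using C_class_DERIV[OF assms, of a] DERIV_shift[of "\<lambda>t. f (x + t *\<^sub>R axis a 1)" _ 0 t]
  by (simp add: algebra_simps)

lemma C_class_cong:
  assumes "open S" "\<And>y. y \<in> S \<Longrightarrow> f y = g y" "C_class k S f"
  shows "C_class k S g"
  using assms(2,3)
proof (induction k arbitrary: f g)
  case 0
  then show ?case by (simp cong: continuous_on_cong)
next
  case (Suc k)
  have "C_class k S (partial_deriv a g)" for a
    by (rule Suc.IH[of "partial_deriv a f"])
      (use Suc.prems in \<open>auto intro: partial_deriv_cong[OF assms(1)]\<close>)
  moreover have "(\<lambda>t. g (x + t *\<^sub>R axis a 1)) differentiable (at 0)" if "x \<in> S" for x a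
    by (rule line_differentiable_cong[OF assms(1) that Suc.prems(1)]) (use that Suc.prems in auto)
  moreover have "continuous_on S g"
    using C_class_imp_continuous[OF Suc.prems(2)] Suc.prems(1) by (simp cong: continuous_on_cong)
  ultimately show ?case by simp
qed

lemma C_class_subset: "C_class k S f \<Longrightarrow> S' \<subseteq> S \<Longrightarrow> C_class k S' f"
  by (induction k arbitrary: f) (auto intro: continuous_on_subset)

text \<open>The explicit derivatives \<open>D\<close> agree with \<open>partial_deriv\<close> on
  \<open>S\<close>, and smoothness depends only on the values on an open \<open>S\<close>.\<close>

lemma C_class_SucI:
  assumes "open S" "continuous_on S f"
    and "\<And>a x. x \<in> S \<Longrightarrow> ((\<lambda>t. f (x + t *\<^sub>R axis a 1)) has_real_derivative D a x) (at 0)"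
    and "\<And>a. C_class k S (D a)"
  shows "C_class (Suc k) S f"
proof -
  have "C_class k S (partial_deriv a f)" for a
    by (rule C_class_cong[OF assms(1) _ assms(4)[of a]]) (metis partial_derivI assms(3))
  then show ?thesis using assms by (auto simp: real_differentiable_def)
qed

lemma C_class_const: "open S \<Longrightarrow> C_class k S (\<lambda>x. c)"
proof (induction k arbitrary: c)
  case (Suc k)
  show ?case by (rule C_class_SucI[where D = "\<lambda>_ _. 0"]) (use Suc in auto)
qed simp

lemma C_class_add:
  assumes "open S" "C_class k S f" "C_class k S g"
  shows "C_class k S (\<lambda>x. f x + g x)"
  using assms(2,3)
proof (induction k arbitrary: f g)
  case 0 then show ?case by (auto intro: continuous_intros)
next
  case (Suc k)
  show ?case
    by (rule C_class_SucI[where D = "\<lambda>a x. partial_deriv a f x + partial_deriv a g x"])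
      (intro assms(1) continuous_on_add C_class_imp_continuous[OF Suc.prems(1)]
        C_class_imp_continuous[OF Suc.prems(2)] Suc.IH C_class_partial_deriv Suc.prems
        DERIV_add C_class_DERIV[OF Suc.prems(1)] C_class_DERIV[OF Suc.prems(2)]; assumption)+
qed

lemma C_class_mult:
  assumes "open S" "C_class k S f" "C_class k S g"
  shows "C_class k S (\<lambda>x. f x * g x)"
  using assms(2,3)
proof (induction k arbitrary: f g)
  case 0 then show ?case by (auto intro: continuous_intros)
next
  case (Suc k)
  show ?case
  \<comment> \<open>The summands have the shape that \<open>DERIV_mult\<close> produces. The
    undifferentiated factor of each is lowered to class \<open>k\<close> for the induction
    hypothesis.\<close>
  proof (rule C_class_SucI[where D = "\<lambda>a x. partial_deriv a f x * g x + partial_deriv a g x * f x"])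
    fix a x assume "x \<in> S"
    show "((\<lambda>t. f (x + t *\<^sub>R axis a 1) * g (x + t *\<^sub>R axis a 1)) has_real_derivative
      partial_deriv a f x * g x + partial_deriv a g x * f x) (at 0)"
      using DERIV_mult[OF C_class_DERIV[OF Suc.prems(1) \<open>x \<in> S\<close>] C_class_DERIV[OF Suc.prems(2) \<open>x \<in> S\<close>]]
      by simp
  qed (intro assms(1) continuous_on_mult C_class_imp_continuous[OF Suc.prems(1)]
        C_class_imp_continuous[OF Suc.prems(2)] C_class_add Suc.IH C_class_partial_deriv Suc.prems
        C_class_Suc_D[OF Suc.prems(1)] C_class_Suc_D[OF Suc.prems(2)])+
qed

lemma C_class_sum:
  assumes "open S" "\<And>i. i \<in> I \<Longrightarrow> C_class k S (f i)"
  shows "C_class k S (\<lambda>x. \<Sum>i\<in>I. f i x)"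
  using assms(2)
  by (induction I rule: infinite_finite_induct) (auto intro: C_class_add C_class_const assms(1))

lemma partial_deriv_add:
  assumes "C_class (Suc k) S f" "C_class (Suc l) S g" "x \<in> S"
  shows "partial_deriv a (\<lambda>x. f x + g x) x = partial_deriv a f x + partial_deriv a g x"
  by (intro partial_derivI DERIV_add C_class_DERIV[OF assms(1)] C_class_DERIV[OF assms(2)] assms(3))

lemma partial_deriv_mult:
  assumes "C_class (Suc k) S f" "C_class (Suc l) S g" "x \<in> S"
  shows "partial_deriv a (\<lambda>x. f x * g x) x = partial_deriv a f x * g x + f x * partial_deriv a g x"
  using DERIV_mult[OF C_class_DERIV[OF assms(1,3)] C_class_DERIV[OF assms(2,3)], of a a]
  by (intro partial_derivI) (simp add: algebra_simps)

lemma partial_deriv_cmult: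
  assumes "C_class (Suc k) S f" "x \<in> S"
  shows "partial_deriv a (\<lambda>x. c * f x) x = c * partial_deriv a f x"
  by (intro partial_derivI DERIV_cmult C_class_DERIV[OF assms])

lemma partial_deriv_const: "partial_deriv a (\<lambda>x. c) = (\<lambda>x. 0)"
  by (simp add: partial_deriv_def fun_eq_iff)

text \<open>Iterated derivatives are indexed by words of directions rather than by multi-indices: this gives
  plain list inductions, and for functions of sufficient smoothness only the multiset of letters matters
  (\<open>word_deriv_mset_eq\<close> below).\<close>

abbreviation word_deriv :: "'n::finite list \<Rightarrow> (real ^ 'n \<Rightarrow> real) \<Rightarrow> real ^ 'n \<Rightarrow> real"
  where "word_deriv \<equiv> fold partial_deriv"

text \<open>\<open>fold\<close> applies the first letter first, so list induction with
  \<open>f\<close> general strips off the innermost derivative.\<close>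

lemma C_class_word_deriv:
  "C_class (length w + k) S f \<Longrightarrow> C_class k S (word_deriv w f)"
  by (induction w arbitrary: f) (auto dest: C_class_partial_deriv simp del: C_class.simps)

lemma word_deriv_cong:
  assumes "open S" "x \<in> S" "\<And>y. y \<in> S \<Longrightarrow> f y = g y"
  shows "word_deriv w f x = word_deriv w g x"
  using assms(3)
proof (induction w arbitrary: f g)
  case Nil then show ?case using assms(2) by simp
next
  case (Cons a w)
  show ?case unfolding fold.simps comp_def
    by (rule Cons.IH) (rule partial_deriv_cong[OF assms(1) _ Cons.prems])
qed

lemma word_deriv_const_0: "word_deriv w (\<lambda>x. 0) = (\<lambda>x. 0)"
  by (induction w) (simp_all add: partial_deriv_const)

lemma word_deriv_add:
  assumes "open S" "x \<in> S" "C_class (length w) S f" "C_class (length w) S g"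
  shows "word_deriv w (\<lambda>x. f x + g x) x = word_deriv w f x + word_deriv w g x"
  using assms(3,4)
proof (induction w arbitrary: f g)
  case (Cons a w)
  note C = Cons.prems[unfolded list.size add_0_right add_Suc_right]
  \<comment> \<open>The sum rule for the first letter is available only on \<open>S\<close>;
    locality carries it under the remaining derivatives.\<close>
  have "word_deriv w (partial_deriv a (\<lambda>x. f x + g x)) x
      = word_deriv w (\<lambda>x. partial_deriv a f x + partial_deriv a g x) x"
    by (rule word_deriv_cong[OF assms(1,2)]) (use C in \<open>auto intro: partial_deriv_add simp del: C_class.simps\<close>)
  also have "\<dots> = word_deriv w (partial_deriv a f) x + word_deriv w (partial_deriv a g) x"
    using Cons.prems by (intro Cons.IH) auto
  finally show ?case by simp
qed simp

lemma word_deriv_cmult: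
  assumes "open S" "x \<in> S" "C_class (length w) S f"
  shows "word_deriv w (\<lambda>x. c * f x) x = c * word_deriv w f x"
  using assms(3)
proof (induction w arbitrary: f)
  case (Cons a w)
  note C = Cons.prems[unfolded list.size add_0_right add_Suc_right]
  have "word_deriv w (partial_deriv a (\<lambda>x. c * f x)) x
      = word_deriv w (\<lambda>x. c * partial_deriv a f x) x"
    by (rule word_deriv_cong[OF assms(1,2)]) (rule partial_deriv_cmult[OF C])
  also have "\<dots> = c * word_deriv w (partial_deriv a f) x"
    using Cons.prems by (intro Cons.IH) auto
  finally show ?case by simp
qed simp

lemma word_deriv_sum:
  assumes "open S" "x \<in> S" "\<And>i. i \<in> I \<Longrightarrow> C_class (length w) S (f i)"
  shows "word_deriv w (\<lambda>x. \<Sum>i\<in>I. f i x) x = (\<Sum>i\<in>I. word_deriv w (f i) x)"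
  using assms(3)
  \<comment> \<open>For infinite \<open>I\<close> both sums are 0 by convention.\<close>
  by (induction I rule: infinite_finite_induct)
    (auto simp: word_deriv_const_0 word_deriv_add[OF assms(1,2)] C_class_sum[OF assms(1)])

lemma word_deriv_diff:
  assumes "open S" "x \<in> S" "C_class (length w) S f" "C_class (length w) S g"
  shows "word_deriv w (\<lambda>x. f x - g x) x = word_deriv w f x - word_deriv w g x"
  using word_deriv_add[OF assms(1-3), of "\<lambda>x. (-1) * g x"]
    word_deriv_cmult[OF assms(1,2,4), of "-1"] C_class_mult[OF assms(1) C_class_const[OF assms(1)] assms(4), of "-1"]
  by simp

lemma C_class_diff:
  assumes "open S" "C_class k S f" "C_class k S g"
  shows "C_class k S (\<lambda>x. f x - g x)"
  using C_class_add[OF assms(1,2) C_class_mult[OF assms(1) C_class_const[OF assms(1)] assms(3), of "-1"]]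
  by simp

text \<open>By the Leibniz rule every term contains a derivative of \<open>g\<close> of order at
  most \<open>length w\<close>. One product rule per letter is enough: each of its two products
  again satisfies the hypotheses, for the shorter word.\<close>

lemma word_deriv_mult_eq_0:
  assumes "open S" "x \<in> S" "C_class (length w) S f" "C_class (length w) S g"
    and "\<And>v. length v \<le> length w \<Longrightarrow> word_deriv v g x = 0"
  shows "word_deriv w (\<lambda>x. f x * g x) x = 0"
  using assms(3-)
proof (induction w arbitrary: f g)
  case Nil then show ?case by force
next
  case (Cons a w)
  note C = Cons.prems(1,2)[unfolded list.size add_0_right add_Suc_right]
  have "word_deriv w (partial_deriv a (\<lambda>x. f x * g x)) x
      = word_deriv w (\<lambda>x. partial_deriv a f x * g x + f x * partial_deriv a g x) x"
    by (rule word_deriv_cong[OF assms(1,2)]) (rule partial_deriv_mult[OF C])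
  also have "\<dots> = word_deriv w (\<lambda>x. partial_deriv a f x * g x) x
      + word_deriv w (\<lambda>x. f x * partial_deriv a g x) x"
    by (intro word_deriv_add[OF assms(1,2)] C_class_mult[OF assms(1)])
      (use C in \<open>auto intro: C_class_Suc_D C_class_partial_deriv simp del: C_class.simps\<close>)
  also have "word_deriv w (\<lambda>x. partial_deriv a f x * g x) x = 0"
    by (rule Cons.IH) (use C Cons.prems(3) in \<open>auto intro: C_class_Suc_D C_class_partial_deriv simp del: C_class.simps\<close>)
  \<comment> \<open>A derivative of \<open>partial_deriv a g\<close> along \<open>v\<close> is one
    of \<open>g\<close> along \<open>a # v\<close>.\<close>
  also have "word_deriv w (\<lambda>x. f x * partial_deriv a g x) x = 0"
    by (rule Cons.IH) (use C Cons.prems(3)[of "a # _"] in \<open>auto intro: C_class_Suc_D C_class_partial_deriv simp del: C_class.simps\<close>)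
  finally show ?case by simp
qed

lemma line_in_ball:
  assumes "norm (y - x) \<le> c" "c + \<bar>t\<bar> < r"
  shows "y + t *\<^sub>R axis a (1::real) \<in> ball x r"
proof -
  have "norm ((y - x) + t *\<^sub>R axis a (1::real)) \<le> norm (y - x) + \<bar>t\<bar>"
    by (rule order_trans[OF norm_triangle_ineq]) simp
  with assms show ?thesis by (simp add: dist_norm norm_minus_commute algebra_simps)
qed

lemma line_MVT:
  assumes "C_class (Suc k) S f" "0 < s" "\<And>t. 0 \<le> t \<Longrightarrow> t \<le> s \<Longrightarrow> x + t *\<^sub>R axis a 1 \<in> S"
  shows "\<exists>t. 0 < t \<and> t < s \<and>
    f (x + s *\<^sub>R axis a 1) - f x = s * partial_deriv a f (x + t *\<^sub>R axis a 1)"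
  using MVT2[OF assms(2), of "\<lambda>t. f (x + t *\<^sub>R axis a 1)" "\<lambda>t. partial_deriv a f (x + t *\<^sub>R axis a 1)"]
    C_class_DERIV_line[OF assms(1) assms(3)]
  by auto

subsection \<open>Symmetry of mixed derivatives\<close>

text \<open>Two applications of the mean value theorem: along \<open>a\<close> to the difference of
  \<open>f\<close> between two lines that are \<open>s\<close> apart in direction \<open>b\<close>,
  then along \<open>b\<close> to \<open>partial_deriv a f\<close>. Both intermediate steps are
  shorter than \<open>s\<close>.\<close>

lemma second_difference:
  assumes "C_class (Suc (Suc k)) S f" "ball x r \<subseteq> S" "0 < s" "2 * s < r"
  shows "\<exists>\<xi>\<in>cball x (2 * s).
    f (x + s *\<^sub>R axis a 1 + s *\<^sub>R axis b 1) - f (x + s *\<^sub>R axis a 1) - f (x + s *\<^sub>R axis b 1) + f x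
      = s * s * partial_deriv b (partial_deriv a f) \<xi>"
proof -
  have line: "y + t *\<^sub>R axis c (1::real) \<in> S" if "norm (y - x) \<le> s" "0 \<le> t" "t \<le> s" for y t c
    using line_in_ball[of y x s t r c] that assms by auto
  have D: "((\<lambda>t. f (x + s *\<^sub>R axis b 1 + t *\<^sub>R axis a 1) - f (x + t *\<^sub>R axis a 1)) has_real_derivative
      partial_deriv a f (x + s *\<^sub>R axis b 1 + t *\<^sub>R axis a 1) - partial_deriv a f (x + t *\<^sub>R axis a 1)) (at t)"
    if "0 \<le> t" "t \<le> s" for t
    by (intro DERIV_diff C_class_DERIV_line[OF assms(1)] line) (use that assms in auto)
  obtain t where t: "0 < t" "t < s" and eq1:
    "(f (x + s *\<^sub>R axis b 1 + s *\<^sub>R axis a 1) - f (x + s *\<^sub>R axis a 1)) - (f (x + s *\<^sub>R axis b 1) - f x)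
     = s * (partial_deriv a f (x + s *\<^sub>R axis b 1 + t *\<^sub>R axis a 1) - partial_deriv a f (x + t *\<^sub>R axis a 1))"
    using MVT2[OF assms(3) D] by auto
  obtain t' where t': "0 < t'" "t' < s" and eq2:
    "partial_deriv a f (x + t *\<^sub>R axis a 1 + s *\<^sub>R axis b 1) - partial_deriv a f (x + t *\<^sub>R axis a 1)
     = s * partial_deriv b (partial_deriv a f) (x + t *\<^sub>R axis a 1 + t' *\<^sub>R axis b 1)"
    using line_MVT[OF C_class_partial_deriv[OF assms(1)] assms(3), of "x + t *\<^sub>R axis a 1" b a]
      line[of "x + t *\<^sub>R axis a 1"] t by auto
  let ?\<xi> = "x + t *\<^sub>R axis a 1 + t' *\<^sub>R axis b 1"
  have "norm (t *\<^sub>R axis a (1::real) + t' *\<^sub>R axis b 1) \<le> 2 * s"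
    by (rule order_trans[OF norm_triangle_ineq]) (use t t' in simp)
  then have "?\<xi> \<in> cball x (2 * s)"
    by (metis add.assoc add_diff_cancel_left' dist_commute dist_norm mem_cball)
  moreover have "f (x + s *\<^sub>R axis a 1 + s *\<^sub>R axis b 1) - f (x + s *\<^sub>R axis a 1) - f (x + s *\<^sub>R axis b 1) + f x
      = s * s * partial_deriv b (partial_deriv a f) ?\<xi>"
    using eq1 eq2 by (simp add: algebra_simps)
  ultimately show ?thesis by blast
qed

text \<open>The second difference is symmetric in \<open>a\<close> and \<open>b\<close>, so both
  mixed derivatives attain a common value, each at some point near \<open>x\<close>. Continuity
  brings this back to \<open>x\<close>.\<close>

lemma partial_deriv_commute:
  assumes "open S" "x \<in> S" "C_class (Suc (Suc k)) S f"
  shows "partial_deriv a (partial_deriv b f) x = partial_deriv b (partial_deriv a f) x"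
proof (rule ccontr)
  let ?P = "partial_deriv a (partial_deriv b f)" and ?Q = "partial_deriv b (partial_deriv a f)"
  \<comment> \<open>Half the gap: numbers less than \<open>e\<close> away from the two values at
    \<open>x\<close> cannot coincide.\<close>
  define e where "e = \<bar>?P x - ?Q x\<bar> / 2"
  assume "?P x \<noteq> ?Q x"
  then have e: "0 < e" by (simp add: e_def)
  have cont: "isCont ?P x" "isCont ?Q x"
    using assms C_class_imp_continuous[OF C_class_partial_deriv[OF C_class_partial_deriv[OF assms(3)]]]
    by (auto simp: continuous_on_eq_continuous_at)
  then obtain r1 r2 where r12: "0 < r1" "0 < r2"
    "\<And>y. dist y x < r1 \<Longrightarrow> \<bar>?P y - ?P x\<bar> < e" "\<And>y. dist y x < r2 \<Longrightarrow> \<bar>?Q y - ?Q x\<bar> < e"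
    using e unfolding continuous_at_eps_delta dist_real_def by metis
  obtain r3 where r3: "0 < r3" "ball x r3 \<subseteq> S"
    using assms(1,2) open_contains_ball by blast
  define s where "s = min (min r1 r2) r3 / 3"
  have s: "0 < s" "2 * s < r1" "2 * s < r2" "2 * s < r3"
    using r12 r3 by (auto simp: s_def)
  obtain \<xi> where \<xi>: "\<xi> \<in> cball x (2 * s)"
    "f (x + s *\<^sub>R axis b 1 + s *\<^sub>R axis a 1) - f (x + s *\<^sub>R axis b 1) - f (x + s *\<^sub>R axis a 1) + f x
      = s * s * ?P \<xi>"
    using second_difference[OF assms(3) r3(2) s(1,4)] by blast
  obtain \<eta> where \<eta>: "\<eta> \<in> cball x (2 * s)"
    "f (x + s *\<^sub>R axis a 1 + s *\<^sub>R axis b 1) - f (x + s *\<^sub>R axis a 1) - f (x + s *\<^sub>R axis b 1) + f x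
      = s * s * ?Q \<eta>"
    using second_difference[OF assms(3) r3(2) s(1,4)] by blast
  have "s * s * ?P \<xi> = s * s * ?Q \<eta>"
    using \<xi>(2) \<eta>(2) unfolding add.assoc[of x] add.commute[of "s *\<^sub>R axis b 1"] by linarith
  then have "?P \<xi> = ?Q \<eta>" using s by simp
  moreover have "\<bar>?P \<xi> - ?P x\<bar> < e" "\<bar>?Q \<eta> - ?Q x\<bar> < e"
    using r12(3)[of \<xi>] r12(4)[of \<eta>] \<xi>(1) \<eta>(1) s by (auto simp: dist_commute)
  moreover have "2 * e = \<bar>?P x - ?Q x\<bar>" by (simp add: e_def)
  ultimately show False by (smt (verit))
qed

text \<open>The induction hypothesis brings \<open>c\<close> directly behind the first letter
  \<open>b\<close>; then the two innermost derivatives are exchanged.\<close>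

lemma word_deriv_move_to_front:
  assumes "open S" "x \<in> S" "C_class (Suc (length (l @ r))) S f"
  shows "word_deriv (l @ c # r) f x = word_deriv (c # l @ r) f x"
  using assms(3)
proof (induction l arbitrary: f)
  case (Cons b l)
  have "word_deriv (l @ c # r) (partial_deriv b f) x = word_deriv (c # l @ r) (partial_deriv b f) x"
    using Cons.prems by (intro Cons.IH) simp
  also have "\<dots> = word_deriv (l @ r) (partial_deriv c (partial_deriv b f)) x" by simp
  also have "\<dots> = word_deriv (l @ r) (partial_deriv b (partial_deriv c f)) x"
    by (rule word_deriv_cong[OF assms(1,2)], rule partial_deriv_commute[OF assms(1)])
      (use Cons.prems in \<open>simp_all del: C_class.simps\<close>)
  finally show ?case by simp
qed simp

text \<open>The first letter of \<open>w\<close> is located in \<open>w'\<close> and moved to its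
  front; what remains has equal multisets.\<close>

lemma word_deriv_mset_eq:
  assumes "open S" "x \<in> S" "C_class (length w) S f" "mset w = mset w'"
  shows "word_deriv w f x = word_deriv w' f x"
  using assms(3,4)
proof (induction w arbitrary: f w')
  case (Cons c v)
  have "c \<in> set w'" using Cons.prems(2) by (metis list.set_intros(1) mset_eq_setD)
  then obtain l r where w': "w' = l @ c # r" by (meson split_list)
  have m: "mset v = mset (l @ r)" using Cons.prems(2) w' by simp
  then have len: "length v = length (l @ r)" by (rule mset_eq_length)
  have "word_deriv v (partial_deriv c f) x = word_deriv (l @ r) (partial_deriv c f) x"
    using Cons.prems m by (intro Cons.IH) auto
  moreover have "word_deriv w' f x = word_deriv (c # l @ r) f x"
    unfolding w' using Cons.prems(1) len
    by (intro word_deriv_move_to_front[OF assms(1,2)]) (simp del: C_class.simps)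
  ultimately show ?case by simp
qed simp

subsection \<open>Taylor expansion along a segment\<close>

text \<open>The coordinates in \<open>A\<close> are changed one at a time, each at a cost of at most
  \<open>e * norm h\<close>. For \<open>A = UNIV\<close> this yields total differentiability from
  continuity of the partial derivatives.\<close>

lemma increment_estimate:
  assumes C: "C_class (Suc k) S f" and r: "ball x r \<subseteq> S"
    and e: "\<And>y b. y \<in> ball x r \<Longrightarrow> \<bar>partial_deriv b f y - partial_deriv b f x\<bar> \<le> e"
    and A: "finite A"
    and h: "norm h < r" "\<And>b. b \<notin> A \<Longrightarrow> h $ b = 0"
  shows "\<bar>f (x + h) - f x - (\<Sum>b\<in>A. h $ b * partial_deriv b f x)\<bar> \<le> real (card A) * (e * norm h)"
  using A h
proof (induction A arbitrary: h rule: finite_induct)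
  case empty
  then have "h = 0" by (simp add: vec_eq_iff)
  then show ?case by simp
next
  case (insert b A)
  \<comment> \<open>Coordinate \<open>b\<close> is set to 0. The path from \<open>x + h'\<close> to
    \<open>x + h\<close> along axis \<open>b\<close> stays in the ball, as no component exceeds that
    of \<open>h\<close>.\<close>
  define h' where "h' = h - (h $ b) *\<^sub>R axis b 1"
  have h'_nth: "h' $ c = (if c = b then 0 else h $ c)" for c by (simp add: h'_def axis_def)
  have h'_norm: "norm (h' + t *\<^sub>R axis b 1) \<le> norm h" if "\<bar>t\<bar> \<le> \<bar>h $ b\<bar>" for t
    by (rule norm_le_componentwise_cart) (use that in \<open>auto simp: h'_nth axis_def\<close>)
  have in_ball: "x + h' + t *\<^sub>R axis b 1 \<in> ball x r" if "\<bar>t\<bar> \<le> \<bar>h $ b\<bar>" for t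
  proof -
    have "dist x (x + y) = norm y" for y :: "real ^ 'a" by (simp add: dist_norm)
    then show ?thesis using h'_norm[OF that] insert.prems(1) by (simp add: add.assoc)
  qed
  \<comment> \<open>With the linear part subtracted, the derivative along the path is at most
    \<open>e\<close> in absolute value.\<close>
  let ?g = "\<lambda>t. f (x + h' + t *\<^sub>R axis b 1) - t * partial_deriv b f x"
  have D: "(?g has_real_derivative
      partial_deriv b f (x + h' + t *\<^sub>R axis b 1) - partial_deriv b f x) (at t)" if "\<bar>t\<bar> \<le> \<bar>h $ b\<bar>" for t
    by (rule DERIV_diff, rule C_class_DERIV_line[OF C], use in_ball[OF that] r in blast)
      (auto intro!: derivative_eq_intros)
  have "norm (?g (h $ b) - ?g 0) \<le> e * norm (h $ b - 0)"
  proof (rule field_differentiable_bound[where S = "cball 0 \<bar>h $ b\<bar>"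
        and f' = "\<lambda>t. partial_deriv b f (x + h' + t *\<^sub>R axis b 1) - partial_deriv b f x"])
    fix t :: real assume "t \<in> cball 0 \<bar>h $ b\<bar>"
    then have t: "\<bar>t\<bar> \<le> \<bar>h $ b\<bar>" by simp
    show "(?g has_field_derivative partial_deriv b f (x + h' + t *\<^sub>R axis b 1) - partial_deriv b f x)
        (at t within cball 0 \<bar>h $ b\<bar>)"
      by (rule has_field_derivative_at_within[OF D[OF t]])
    show "norm (partial_deriv b f (x + h' + t *\<^sub>R axis b 1) - partial_deriv b f x) \<le> e"
      using e[OF in_ball[OF t]] by simp
  qed auto
  moreover have "x + h' + (h $ b) *\<^sub>R axis b 1 = x + h" by (simp add: h'_def)
  ultimately have 1: "\<bar>f (x + h) - f (x + h') - h $ b * partial_deriv b f x\<bar> \<le> e * \<bar>h $ b\<bar>"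
    by simp
  have e0: "0 \<le> e" by (rule order_trans[OF abs_ge_zero e[OF in_ball[of 0]]]) simp
  have "\<bar>f (x + h') - f x - (\<Sum>b\<in>A. h' $ b * partial_deriv b f x)\<bar> \<le> real (card A) * (e * norm h')"
    using h'_norm[of 0] insert.prems by (intro insert.IH) (auto simp: h'_nth)
  also have "\<dots> \<le> real (card A) * (e * norm h)"
    using h'_norm[of 0] e0 by (intro mult_left_mono) auto
  also have "(\<Sum>b\<in>A. h' $ b * partial_deriv b f x) = (\<Sum>b\<in>A. h $ b * partial_deriv b f x)"
    using insert.hyps by (intro sum.cong) (auto simp: h'_nth)
  finally have 2: "\<bar>f (x + h') - f x - (\<Sum>b\<in>A. h $ b * partial_deriv b f x)\<bar> \<le> real (card A) * (e * norm h)" .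
  have "e * \<bar>h $ b\<bar> \<le> e * norm h" using e0 component_le_norm_cart[of h b] by (rule mult_left_mono[rotated])
  with 1 2 insert.hyps show ?case by (simp add: algebra_simps abs_if split: if_splits)
qed

lemma C_class_has_derivative:
  fixes f :: "real ^ 'n::finite \<Rightarrow> real"
  assumes "open S" "x \<in> S" "C_class (Suc k) S f"
  shows "(f has_derivative (\<lambda>h. \<Sum>b\<in>UNIV. h $ b * partial_deriv b f x)) (at x)"
  unfolding has_derivative_at_alt
proof (intro conjI allI impI)
  show "bounded_linear (\<lambda>h. \<Sum>b\<in>UNIV. h $ b * partial_deriv b f x)"
    by (intro bounded_linear_sum bounded_linear_mult_left[THEN bounded_linear_compose] bounded_linear_vec_nth)
  fix e :: real assume "0 < e"
  \<comment> \<open>Compensates the factor \<open>card A\<close> in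
    \<open>increment_estimate\<close>.\<close>
  define e' where "e' = e / real CARD('n)"
  have e': "0 < e'" using \<open>0 < e\<close> by (simp add: e'_def)
  have "\<forall>b. \<exists>r>0. \<forall>y. dist y x < r \<longrightarrow> \<bar>partial_deriv b f y - partial_deriv b f x\<bar> < e'"
  proof
    fix b
    have "isCont (partial_deriv b f) x"
      using assms C_class_imp_continuous[OF C_class_partial_deriv[OF assms(3)]]
      by (auto simp: continuous_on_eq_continuous_at)
    then show "\<exists>r>0. \<forall>y. dist y x < r \<longrightarrow> \<bar>partial_deriv b f y - partial_deriv b f x\<bar> < e'"
      using e' unfolding continuous_at_eps_delta dist_real_def by blast
  qed
  then obtain r where r: "\<And>b. 0 < r b"
    "\<And>b y. dist y x < r b \<Longrightarrow> \<bar>partial_deriv b f y - partial_deriv b f x\<bar> < e'" by metis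
  obtain r0 where r0: "0 < r0" "ball x r0 \<subseteq> S"
    using assms(1,2) open_contains_ball by blast
  define d where "d = min r0 (Min (range r))"
  have d: "0 < d" "d \<le> r0" "\<And>b. d \<le> r b" using r0 r(1) by (auto simp: d_def min.coboundedI2)
  show "\<exists>d>0. \<forall>y. norm (y - x) < d \<longrightarrow>
      norm (f y - f x - (\<Sum>b\<in>UNIV. (y - x) $ b * partial_deriv b f x)) \<le> e * norm (y - x)"
  proof (intro exI conjI allI impI)
    fix y assume y: "norm (y - x) < d"
    have "\<bar>f (x + (y - x)) - f x - (\<Sum>b\<in>UNIV. (y - x) $ b * partial_deriv b f x)\<bar>
        \<le> real (card (UNIV :: 'n set)) * (e' * norm (y - x))"
    proof (rule increment_estimate[OF assms(3)])
      show "ball x d \<subseteq> S" using d r0 by auto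
      show "\<bar>partial_deriv b f z - partial_deriv b f x\<bar> \<le> e'" if "z \<in> ball x d" for z b
        using r(2)[of z b] d(3)[of b] that by (simp add: dist_commute)
    qed (use y in auto)
    then show "norm (f y - f x - (\<Sum>b\<in>UNIV. (y - x) $ b * partial_deriv b f x)) \<le> e * norm (y - x)"
      by (simp add: e'_def)
  qed (rule d)
qed

text \<open>The \<open>n\<close>-th derivative along \<open>h\<close>. The recursion differentiates the function first, so that no
  linearity of \<open>dir_deriv n h\<close> is needed to see that it satisfies the chain rule.\<close>

primrec dir_deriv :: "nat \<Rightarrow> real ^ 'n::finite \<Rightarrow> (real ^ 'n \<Rightarrow> real) \<Rightarrow> real ^ 'n \<Rightarrow> real" where
  "dir_deriv 0 h f y = f y"
| "dir_deriv (Suc n) h f y = (\<Sum>b\<in>UNIV. h $ b * dir_deriv n h (partial_deriv b f) y)"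

text \<open>The base case is the chain rule for the total derivative. In the step the induction
  hypothesis for each \<open>partial_deriv b f\<close> is summed with the constant weights
  \<open>h $ b\<close>.\<close>

lemma dir_deriv_DERIV:
  assumes "open S" "a + t *\<^sub>R h \<in> S" "C_class (Suc n) S f"
  shows "((\<lambda>t. dir_deriv n h f (a + t *\<^sub>R h)) has_real_derivative
    dir_deriv (Suc n) h f (a + t *\<^sub>R h)) (at t)"
  using assms(3)
proof (induction n arbitrary: f)
  case 0
  have "((\<lambda>t. f (a + t *\<^sub>R h)) has_derivative
      (\<lambda>s. \<Sum>b\<in>UNIV. (s *\<^sub>R h) $ b * partial_deriv b f (a + t *\<^sub>R h))) (at t)"
    by (rule has_derivative_compose[where f = "\<lambda>t. a + t *\<^sub>R h", OF _ C_class_has_derivative[OF assms(1,2) 0]])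
      (auto intro!: derivative_eq_intros)
  then show ?case
    unfolding has_field_derivative_def dir_deriv.simps
    by (rule has_derivative_eq_rhs) (simp add: fun_eq_iff sum_distrib_left mult_ac)
next
  case (Suc n)
  have "((\<lambda>t. \<Sum>b\<in>UNIV. h $ b * dir_deriv n h (partial_deriv b f) (a + t *\<^sub>R h)) has_real_derivative
      (\<Sum>b\<in>UNIV. h $ b * dir_deriv (Suc n) h (partial_deriv b f) (a + t *\<^sub>R h))) (at t)"
    by (intro DERIV_sum DERIV_cmult Suc.IH C_class_partial_deriv Suc.prems)
  then show ?case by simp
qed

lemma dir_deriv_bound:
  fixes h :: "real ^ 'n::finite"
  assumes "\<And>b. \<bar>h $ b\<bar> \<le> H" "0 \<le> H"
    and "\<And>w. length w = n \<Longrightarrow> \<bar>word_deriv w f y\<bar> \<le> B"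
  shows "\<bar>dir_deriv n h f y\<bar> \<le> (real CARD('n) * H) ^ n * B"
  using assms(3)
proof (induction n arbitrary: f)
  case 0
  then show ?case using 0[of "[]"] by simp
next
  case (Suc n)
  have IH: "\<bar>dir_deriv n h (partial_deriv b f) y\<bar> \<le> (real CARD('n) * H) ^ n * B" for b
    by (rule Suc.IH) (use Suc.prems[of "b # _"] in simp)
  have "\<bar>dir_deriv (Suc n) h f y\<bar> \<le> (\<Sum>b\<in>(UNIV :: 'n set). H * ((real CARD('n) * H) ^ n * B))"
    unfolding dir_deriv.simps
    by (rule order_trans[OF sum_abs sum_mono]) (auto simp: abs_mult intro!: mult_mono assms IH)
  then show ?case by simp
qed

lemma dir_deriv_eq_0:
  "(\<And>w. length w = n \<Longrightarrow> word_deriv w f y = 0) \<Longrightarrow> dir_deriv n h f y = 0"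
  using dir_deriv_bound[of h "norm h" n f y 0] by (simp add: component_le_norm_cart)

text \<open>The Lagrange form of the remainder for \<open>t \<mapsto> f (a + t *\<^sub>R h)\<close>
  on the unit interval; all lower terms vanish by \<open>zero\<close>.\<close>

lemma taylor_remainder_bound:
  fixes f :: "real ^ 'n::finite \<Rightarrow> real"
  assumes "open S" "closed_segment a x \<subseteq> S" "C_class n S f" "0 < n"
    and zero: "\<And>w. length w < n \<Longrightarrow> word_deriv w f a = 0"
    and B: "\<And>w y. length w = n \<Longrightarrow> y \<in> S \<Longrightarrow> \<bar>word_deriv w f y\<bar> \<le> B"
  shows "\<bar>f x\<bar> \<le> (real CARD('n) * dist a x) ^ n * B / fact n"
proof -
  define h where "h = x - a"
  have seg: "a + t *\<^sub>R h \<in> S" if "0 \<le> t" "t \<le> 1" for t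
  proof -
    have "a + t *\<^sub>R h = (1 - t) *\<^sub>R a + t *\<^sub>R x" by (simp add: h_def algebra_simps)
    then show ?thesis using assms(2) that by (auto simp: closed_segment_def)
  qed
  \<comment> \<open>The factors 1 and 0 stay visible to match the shape of
    \<open>Maclaurin\<close>.\<close>
  have "\<exists>t>0. t < 1 \<and> f (a + 1 *\<^sub>R h) =
    (\<Sum>m<n. dir_deriv m h f (a + 0 *\<^sub>R h) / fact m * 1 ^ m) + dir_deriv n h f (a + t *\<^sub>R h) / fact n * 1 ^ n"
    by (rule Maclaurin[where diff = "\<lambda>m t. dir_deriv m h f (a + t *\<^sub>R h)"])
      (use assms(4) in \<open>auto intro!: dir_deriv_DERIV[OF assms(1) seg] C_class_mono[OF _ assms(3)] simp del: dir_deriv.simps(2)\<close>)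
  then obtain t where t: "0 < t" "t < 1" "f x = (\<Sum>m<n. dir_deriv m h f a / fact m) + dir_deriv n h f (a + t *\<^sub>R h) / fact n"
    by (auto simp: h_def)
  have "(\<Sum>m<n. dir_deriv m h f a / fact m) = 0"
    by (rule sum.neutral) (auto intro!: dir_deriv_eq_0 zero)
  moreover have "\<bar>dir_deriv n h f (a + t *\<^sub>R h)\<bar> \<le> (real CARD('n) * dist a x) ^ n * B"
    by (rule dir_deriv_bound)
      (use B seg[of t] t in \<open>auto simp: h_def dist_norm norm_minus_commute[of a] intro: component_le_norm_cart[of "x - a", simplified]\<close>)
  ultimately show ?thesis using t(3) by (simp add: divide_right_mono)
qed

subsection \<open>Multi-indices and monomials\<close>

text \<open>\<open>mderiv\<close> uses \<open>foldr\<close>, which applies the last coordinate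
  first; \<open>rev\<close> adapts this to the order of \<open>fold\<close>.\<close>

definition mi_word :: "'n::finite mindex \<Rightarrow> 'n list"
  where "mi_word i = rev (concat (map (\<lambda>k. replicate (i k) k) coords))"

lemma mderiv_eq_word_deriv: "mderiv i f = word_deriv (mi_word i) f"
proof -
  have rep: "foldr partial_deriv (replicate n k) g = (partial_deriv k ^^ n) g" for n k g
    by (induction n) auto
  have "foldr (\<lambda>k g. (partial_deriv k ^^ i k) g) ks f
      = foldr partial_deriv (concat (map (\<lambda>k. replicate (i k) k) ks)) f" for ks
    by (induction ks) (simp_all add: rep)
  then show ?thesis by (simp add: mderiv_def mi_word_def foldr_conv_fold)
qed

lemma count_mi_word: "count (mset (mi_word i)) = i"
proof
  fix k
  have "distinct ks \<Longrightarrow> count (mset (concat (map (\<lambda>k. replicate (i k) k) ks))) k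
      = (if k \<in> set ks then i k else 0)" for ks
    by (induction ks) auto
  from this[OF distinct_coords] show "count (mset (mi_word i)) k = i k"
    by (simp add: mi_word_def set_coords)
qed

lemma mi_abs_count: "mi_abs (count (mset w)) = length w"
proof (induction w)
  case (Cons a w)
  have "count (mset (a # w)) = (\<lambda>k. count (mset w) k + (if k = a then 1 else 0))" by auto
  then show ?case using Cons by (simp add: mi_abs_def sum.distrib)
qed (simp add: mi_abs_def)

lemma length_mi_word: "length (mi_word i) = mi_abs i"
  using mi_abs_count[of "mi_word i"] by (simp add: count_mi_word)

text \<open>By symmetry a word matters only through its letter counts. Bounds on multi-index
  derivatives, as in the seminorms, thus hold for all words.\<close>

lemma word_deriv_eq_mderiv:
  assumes "open S" "x \<in> S" "C_class (length w) S f"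
  shows "word_deriv w f x = mderiv (count (mset w)) f x"
  unfolding mderiv_eq_word_deriv
  by (rule word_deriv_mset_eq[OF assms]) (simp add: multiset_eq_iff count_mi_word)

lemma mi_abs_decr: "i k \<noteq> 0 \<Longrightarrow> mi_abs i = Suc (mi_abs (i(k := i k - 1)))"
  by (simp add: mi_abs_def sum.remove[of UNIV k])

lemma mi_fact_decr: "i k \<noteq> 0 \<Longrightarrow> mi_fact i = real (i k) * mi_fact (i(k := i k - 1))"
  by (simp add: mi_fact_def prod.remove[of UNIV k] fact_reduce)

text \<open>Along axis \<open>k\<close> only the \<open>k\<close>-th factor varies. For
  \<open>i k = 0\<close> the truncated exponent is harmless, since the leading coefficient is
  0.\<close>

lemma monomial_DERIV:
  "((\<lambda>t. monomial i (x + t *\<^sub>R axis k 1 - a)) has_real_derivative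
    real (i k) * monomial (i(k := i k - 1)) (x - a)) (at 0)"
proof -
  let ?c = "\<Prod>j\<in>UNIV - {k}. (x $ j - a $ j) ^ i j"
  have eq: "monomial i (x + t *\<^sub>R axis k 1 - a) = (x $ k + t - a $ k) ^ i k * ?c" for t
    unfolding monomial_def by (subst prod.remove[of UNIV k]) (auto simp: axis_def intro!: prod.cong)
  have "((\<lambda>t. (x $ k + t - a $ k) ^ i k * ?c) has_real_derivative
      real (i k) * ((x $ k - a $ k) ^ (i k - 1) * ?c)) (at 0)"
    by (auto intro!: derivative_eq_intros)
  also have "(x $ k - a $ k) ^ (i k - 1) * ?c = monomial (i(k := i k - 1)) (x - a)"
    by (simp add: monomial_def prod.remove[of UNIV k])
  finally show ?thesis unfolding eq .
qed

lemma partial_deriv_monomial: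
  "partial_deriv k (\<lambda>x. monomial i (x - a)) = (\<lambda>x. real (i k) * monomial (i(k := i k - 1)) (x - a))"
  by (rule ext, rule partial_derivI, rule monomial_DERIV)

lemma C_class_monomial: "C_class n UNIV (\<lambda>x. monomial i (x - a))"
proof (induction n arbitrary: i)
  case 0
  show ?case unfolding monomial_def C_class.simps by (intro continuous_intros)
next
  case (Suc n)
  show ?case
    by (rule C_class_SucI[OF open_UNIV C_class_imp_continuous[OF Suc] monomial_DERIV])
      (intro C_class_mult C_class_const open_UNIV Suc)
qed

lemma word_deriv_monomial_Cons:
  "word_deriv (k # w) (\<lambda>x. monomial i (x - a)) x
    = real (i k) * word_deriv w (\<lambda>x. monomial (i(k := i k - 1)) (x - a)) x"
  using word_deriv_cmult[OF open_UNIV UNIV_I C_class_monomial, of w "real (i k)"]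
  by (simp add: partial_deriv_monomial)

text \<open>Each letter lowers its exponent by one and contributes the old exponent as a factor. A
  nonzero value at the centre requires that the word uses up all exponents exactly, and then the
  factors multiply to the factorial.\<close>

lemma word_deriv_monomial_at_center:
  "word_deriv w (\<lambda>x. monomial i (x - a)) a = (if count (mset w) = i then mi_fact i else 0)"
proof (induction w arbitrary: i)
  case Nil
  \<comment> \<open>Here \<open>0 ^ 0 = 1\<close> matters: only the zero index gives a nonzero
    value.\<close>
  have "monomial i (0 :: real ^ 'a) = (if (\<lambda>_. 0) = i then mi_fact i else 0)"
    by (auto simp: monomial_def mi_fact_def fun_eq_iff power_0_left)
  then show ?case by simp
next
  case (Cons k w)
  show ?case
  proof (cases "i k = 0")
    case True
    then have "count (mset (k # w)) \<noteq> i" by (auto simp: fun_eq_iff)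
    with True show ?thesis by (simp only: word_deriv_monomial_Cons) simp
  next
    case False
    then have iff: "count (mset (k # w)) = i \<longleftrightarrow> count (mset w) = i(k := i k - 1)"
      by (auto simp: fun_eq_iff)
    show ?thesis
      unfolding word_deriv_monomial_Cons Cons iff mi_fact_decr[of i k, OF False] by simp
  qed
qed

text \<open>Each letter either annihilates the monomial or lowers its degree by one.\<close>

lemma word_deriv_monomial_eq_0:
  "mi_abs i < length w \<Longrightarrow> word_deriv w (\<lambda>x. monomial i (x - a)) x = 0"
proof (induction w arbitrary: i)
  case (Cons k w)
  then have "i k = 0 \<or> mi_abs (i(k := i k - 1)) < length w"
    using mi_abs_decr[of i k] by (cases "i k = 0") auto
  then show ?case unfolding word_deriv_monomial_Cons using Cons.IH by auto
qed simp

subsection \<open>Taylor polynomials\<close>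

lemma mi_fact_nonzero: "mi_fact i \<noteq> 0"
  by (simp add: mi_fact_def)

lemma finite_mi_less: "finite {i :: 'n::finite mindex. mi_abs i < n}"
  by (rule finite_subset[OF _ finite_mi_le[of n]]) auto

lemma C_class_taylor_poly: "C_class k S (taylor_poly n a u)"
proof -
  have "C_class k UNIV (taylor_poly n a u)"
    unfolding taylor_poly_def[abs_def]
    by (intro C_class_sum C_class_mult C_class_const C_class_monomial open_UNIV)
  then show ?thesis by (rule C_class_subset) simp
qed

lemma word_deriv_taylor_poly:
  "word_deriv w (taylor_poly n a u) x =
    (\<Sum>j | mi_abs j < n. 1 / mi_fact j * mderiv j u a * word_deriv w (\<lambda>x. monomial j (x - a)) x)"
proof -
  have "word_deriv w (taylor_poly n a u) x =
      (\<Sum>j | mi_abs j < n. word_deriv w (\<lambda>x. 1 / mi_fact j * mderiv j u a * monomial j (x - a)) x)"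
    unfolding taylor_poly_def[abs_def]
    by (intro word_deriv_sum[OF open_UNIV UNIV_I] C_class_mult C_class_const C_class_monomial open_UNIV)
  then show ?thesis by (simp only: word_deriv_cmult[OF open_UNIV UNIV_I C_class_monomial])
qed

text \<open>Only the term \<open>j = count (mset w)\<close> survives, and its factorial cancels;
  symmetry identifies the coefficient with the derivative along \<open>w\<close>.\<close>

lemma word_deriv_taylor_poly_at_center:
  assumes "open S" "a \<in> S" "C_class (length w) S u" "length w < n"
  shows "word_deriv w (taylor_poly n a u) a = word_deriv w u a"
proof -
  have "word_deriv w (taylor_poly n a u) a
      = (\<Sum>j | mi_abs j < n. if j = count (mset w) then mderiv j u a else 0)"
    unfolding word_deriv_taylor_poly word_deriv_monomial_at_center
    by (intro sum.cong) (auto simp: mi_fact_nonzero)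
  also have "\<dots> = mderiv (count (mset w)) u a"
    using assms(4) by (simp add: finite_mi_less mi_abs_count)
  finally show ?thesis by (simp add: word_deriv_eq_mderiv[OF assms(1-3)])
qed

lemma word_deriv_taylor_poly_eq_0: "n \<le> length w \<Longrightarrow> word_deriv w (taylor_poly n a u) x = 0"
  unfolding word_deriv_taylor_poly by (intro sum.neutral) (auto simp: word_deriv_monomial_eq_0)

section \<open>Closure properties of the polynomial spaces\<close>

lemma monomial_in_poly_space: "mi_abs i \<le> p \<Longrightarrow> (\<lambda>x. c * monomial i x) \<in> poly_space p"
proof -
  assume "mi_abs i \<le> p"
  then have "(\<lambda>x. c * monomial i x) = (\<lambda>x. \<Sum>j | mi_abs j \<le> p. (if j = i then c else 0) * monomial j x)"
    by (intro ext) (simp add: if_distrib[of "\<lambda>c. c * _"] finite_mi_le cong: if_cong)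
  then show ?thesis unfolding poly_space_def by (intro CollectI exI[of _ "\<lambda>j. if j = i then c else 0"])
qed

lemma poly_space_add:
  assumes "f \<in> poly_space p" "g \<in> poly_space p"
  shows "(\<lambda>x. f x + g x) \<in> poly_space p"
proof -
  obtain c d where "f = (\<lambda>x. \<Sum>i | mi_abs i \<le> p. c i * monomial i x)"
    "g = (\<lambda>x. \<Sum>i | mi_abs i \<le> p. d i * monomial i x)"
    using assms unfolding poly_space_def by auto
  then show ?thesis unfolding poly_space_def
    by (intro CollectI exI[of _ "\<lambda>i. c i + d i"]) (simp add: sum.distrib algebra_simps)
qed

lemma poly_space_const: "(\<lambda>x. c) \<in> poly_space p"
  using monomial_in_poly_space[of "\<lambda>_. 0" p c] by (simp add: mi_abs_def monomial_def)

lemma poly_space_sum: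
  "(\<And>i. i \<in> I \<Longrightarrow> f i \<in> poly_space p) \<Longrightarrow> (\<lambda>x. \<Sum>i\<in>I. f i x) \<in> poly_space p"
  by (induction I rule: infinite_finite_induct) (auto intro: poly_space_add poly_space_const)

lemma monomial_mult: "monomial i x * monomial j x = monomial (\<lambda>k. i k + j k) x"
  by (simp add: monomial_def power_add prod.distrib)

lemma poly_space_mult:
  assumes "f \<in> poly_space p" "g \<in> poly_space q"
  shows "(\<lambda>x. f x * g x) \<in> poly_space (p + q)"
proof -
  obtain c d where fg: "f = (\<lambda>x. \<Sum>i | mi_abs i \<le> p. c i * monomial i x)"
    "g = (\<lambda>x. \<Sum>i | mi_abs i \<le> q. d i * monomial i x)"
    using assms unfolding poly_space_def by auto
  have "(\<lambda>x. f x * g x) = (\<lambda>x. \<Sum>i | mi_abs i \<le> p. \<Sum>j | mi_abs j \<le> q.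
      (c i * d j) * monomial (\<lambda>k. i k + j k) x)"
    unfolding fg by (simp add: sum_product monomial_mult[symmetric] mult_ac)
  also have "\<dots> \<in> poly_space (p + q)"
    by (intro poly_space_sum monomial_in_poly_space) (auto simp: mi_abs_def sum.distrib)
  finally show ?thesis .
qed

lemma poly_space_power: "f \<in> poly_space p \<Longrightarrow> (\<lambda>x. f x ^ n) \<in> poly_space (n * p)"
  by (induction n) (auto intro: poly_space_const poly_space_mult)

lemma poly_space_prod:
  "(\<And>k. k \<in> K \<Longrightarrow> f k \<in> poly_space (p k)) \<Longrightarrow> (\<lambda>x. \<Prod>k\<in>K. f k x) \<in> poly_space (sum p K)"
  by (induction K rule: infinite_finite_induct) (auto intro: poly_space_const poly_space_mult)

lemma poly_space_mono:
  assumes "p \<le> q" "f \<in> poly_space p"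
  shows "f \<in> poly_space q"
  using poly_space_mult[OF assms(2) poly_space_const[of 1 "q - p"]] assms(1) by simp

lemma poly_space_component: "(\<lambda>x. x $ k) \<in> poly_space 1"
proof -
  have "monomial (\<lambda>j. if j = k then 1 else 0) x = x $ k" for x :: "real ^ 'a"
    by (simp add: monomial_def if_distrib[of "\<lambda>n. _ ^ n"] prod.delta cong: if_cong)
  then show ?thesis
    using monomial_in_poly_space[of "\<lambda>j. if j = k then 1 else 0" 1 1] by (simp add: mi_abs_def)
qed

text \<open>\<open>poly_space\<close> is spanned by monomials centred at the origin, the Taylor
  polynomial by shifted ones. Closure under sums and products, with degrees adding up, replaces the
  explicit re-expansion.\<close>

lemma taylor_poly_in_poly_space: "taylor_poly (Suc p) a u \<in> poly_space p"
proof -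
  have "(\<lambda>x. (x $ k - a $ k) ^ n) \<in> poly_space n" for k n
    using poly_space_power[OF poly_space_add[OF poly_space_component poly_space_const, of k "- a $ k"], of n]
    by simp
  then have mon: "(\<lambda>x. monomial j (x - a)) \<in> poly_space (mi_abs j)" for j
    unfolding monomial_def mi_abs_def vector_minus_component by (rule poly_space_prod)
  have "(\<lambda>x. c * monomial j (x - a)) \<in> poly_space p" if "mi_abs j < Suc p" for c j
    using poly_space_mono[OF _ poly_space_mult[OF poly_space_const[of c 0] mon[of j]], of p] that
    by simp
  then show ?thesis unfolding taylor_poly_def[abs_def] by (intro poly_space_sum) blast
qed

section \<open>Membership in the quasi-Trefftz space\<close>

lemma taylor_poly_in_quasi_trefftz:
  assumes "open S" "a \<in> S" and C: "C_class (Suc p) S u"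
    and \<alpha>: "\<And>j. mi_abs j \<le> m \<Longrightarrow> C_class (p - m) S (\<alpha> j)"
    and eq: "\<And>x. x \<in> S \<Longrightarrow> diff_op m \<alpha> u x = 0"
  shows "taylor_poly (Suc p) a u \<in> quasi_trefftz p m \<alpha> a"
proof -
  let ?P = "taylor_poly (Suc p) a u"
  define g where "g j = (\<lambda>x. mderiv j ?P x - mderiv j u x)" for j
  have "mderiv i (diff_op m \<alpha> ?P) a = 0" if i: "mi_abs i + m \<le> p" for i
  proof -
    let ?w = "mi_word i"
    have Cj: "C_class (length v) S (mderiv j ?P)" "C_class (length v) S (mderiv j u)"
      if "length v \<le> mi_abs i" "mi_abs j \<le> m" for j v
      unfolding mderiv_eq_word_deriv using that i
      by (auto intro!: C_class_word_deriv C_class_taylor_poly C_class_mono[OF _ C] simp: length_mi_word)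
    \<comment> \<open>The total order \<open>mi_abs j + length v\<close> is at most
      \<open>m + mi_abs i \<le> p\<close>, the range in which the derivatives of \<open>?P\<close>
      and \<open>u\<close> agree at \<open>a\<close>.\<close>
    have g0: "word_deriv v (g j) a = 0" if "length v \<le> mi_abs i" "mi_abs j \<le> m" for j v
    proof -
      have "word_deriv v (g j) a = word_deriv (mi_word j @ v) ?P a - word_deriv (mi_word j @ v) u a"
        unfolding g_def using word_deriv_diff[OF assms(1,2) Cj[OF that]]
        by (simp add: mderiv_eq_word_deriv)
      also have "\<dots> = 0"
        using that i by (subst word_deriv_taylor_poly_at_center[OF assms(1,2)])
          (auto intro!: C_class_mono[OF _ C] simp: length_mi_word)
      finally show ?thesis .
    qed
    have C\<alpha>: "C_class (length ?w) S (\<alpha> j)" and Cg: "C_class (length ?w) S (g j)"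
      if "mi_abs j \<le> m" for j
      using i that Cj[of ?w j] unfolding g_def
      by (auto intro!: C_class_mono[OF _ \<alpha>] C_class_diff assms(1) simp: length_mi_word)
    \<comment> \<open>\<open>diff_op m \<alpha> u\<close> vanishes on all of \<open>S\<close>, so it
      may be subtracted before differentiating.\<close>
    have "mderiv i (diff_op m \<alpha> ?P) a = word_deriv ?w (\<lambda>x. \<Sum>j | mi_abs j \<le> m. \<alpha> j x * g j x) a"
      unfolding mderiv_eq_word_deriv[of i]
    proof (rule word_deriv_cong[OF assms(1,2)])
      fix x assume "x \<in> S"
      then show "diff_op m \<alpha> ?P x = (\<Sum>j | mi_abs j \<le> m. \<alpha> j x * g j x)"
        using eq[of x] by (simp add: g_def diff_op_def right_diff_distrib sum_subtractf)
    qed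
    also have "\<dots> = (\<Sum>j | mi_abs j \<le> m. word_deriv ?w (\<lambda>x. \<alpha> j x * g j x) a)"
      by (rule word_deriv_sum[OF assms(1,2)]) (use C\<alpha> Cg in \<open>auto intro: C_class_mult assms(1)\<close>)
    also have "\<dots> = 0"
      using C\<alpha> Cg
      by (intro sum.neutral ballI word_deriv_mult_eq_0[OF assms(1,2)]) (auto intro: g0 simp: length_mi_word)
    finally show ?thesis .
  qed
  then show ?thesis unfolding quasi_trefftz_def using taylor_poly_in_poly_space by blast
qed

section \<open>The approximation estimate\<close>

lemma C_seminorm_le_iff:
  "C_seminorm k S f \<le> B \<longleftrightarrow> (\<forall>i x. mi_abs i = k \<longrightarrow> x \<in> S \<longrightarrow> ennreal \<bar>mderiv i f x\<bar> \<le> B)"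
  unfolding C_seminorm_def C0_norm_def using mi_eq_nonempty[of k]
  by (subst Max_le_iff) (auto simp: finite_mi_eq SUP_le_iff)

lemma taylor_error_bound:
  fixes u :: "real ^ 'n::finite \<Rightarrow> real"
  assumes "open S" "bounded S" "a \<in> S" "closed_segment a x \<subseteq> S" "C_class (Suc p) S u"
    and q: "mi_abs i \<le> p"
    and B: "\<And>j y. mi_abs j = Suc p \<Longrightarrow> y \<in> S \<Longrightarrow> \<bar>mderiv j u y\<bar> \<le> B"
  shows "\<bar>mderiv i (\<lambda>x. u x - taylor_poly (Suc p) a u x) x\<bar>
    \<le> real CARD('n) ^ (Suc p - mi_abs i) / fact (Suc p - mi_abs i) * diameter S ^ (Suc p - mi_abs i) * B"
proof -
  let ?n = "Suc p - mi_abs i" and ?r = "\<lambda>x. u x - taylor_poly (Suc p) a u x"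
  have deriv: "word_deriv w (mderiv i ?r) y
      = word_deriv (mi_word i @ w) u y - word_deriv (mi_word i @ w) (taylor_poly (Suc p) a u) y"
    if "length w \<le> ?n" "y \<in> S" for w y
  proof -
    have "word_deriv (mi_word i @ w) ?r y
      = word_deriv (mi_word i @ w) u y - word_deriv (mi_word i @ w) (taylor_poly (Suc p) a u) y"
      by (rule word_deriv_diff[OF assms(1) that(2) _ C_class_taylor_poly])
        (rule C_class_mono[OF _ assms(5)], use that q in \<open>simp add: length_mi_word\<close>)
    then show ?thesis by (simp add: mderiv_eq_word_deriv)
  qed
  have "x \<in> S" using assms(4) by auto
  \<comment> \<open>A multi-index of order \<open>Suc p\<close> exists, so \<open>B\<close> bounds
    some absolute value at \<open>x\<close>.\<close>
  have B0: "0 \<le> B"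
    using B[OF _ \<open>x \<in> S\<close>] mi_eq_nonempty[of "Suc p"] by (auto intro: order_trans[OF abs_ge_zero])
  have "\<bar>mderiv i ?r x\<bar> \<le> (real CARD('n) * dist a x) ^ ?n * B / fact ?n"
  proof (rule taylor_remainder_bound[OF assms(1,4)])
    show "C_class ?n S (mderiv i ?r)"
      unfolding mderiv_eq_word_deriv using q
      by (intro C_class_word_deriv C_class_diff[OF assms(1) _ C_class_taylor_poly] C_class_mono[OF _ assms(5)])
        (simp add: length_mi_word)
    show "word_deriv w (mderiv i ?r) a = 0" if "length w < ?n" for w
      unfolding deriv[OF less_imp_le[OF that] assms(3)] using that
      by (subst word_deriv_taylor_poly_at_center[OF assms(1,3)])
        (auto intro!: C_class_mono[OF _ assms(5)] simp: length_mi_word)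
    show "\<bar>word_deriv w (mderiv i ?r) y\<bar> \<le> B" if "length w = ?n" "y \<in> S" for w y
    proof -
      have len: "length (mi_word i @ w) = Suc p" using that q by (simp add: length_mi_word)
      \<comment> \<open>At total order \<open>Suc p\<close> the Taylor polynomial contributes
        nothing, and the word is rewritten as the multi-index for which \<open>B\<close> is
        assumed.\<close>
      have "word_deriv w (mderiv i ?r) y = mderiv (count (mset (mi_word i @ w))) u y"
        using that len assms(5) deriv[of w y] word_deriv_taylor_poly_eq_0[of "Suc p" "mi_word i @ w" a u y]
          word_deriv_eq_mderiv[OF assms(1) that(2), of "mi_word i @ w" u]
        by (simp del: C_class.simps)
      then show ?thesis using B[OF _ that(2)] len by (simp only: mi_abs_count)
    qed
  qed (use q in simp)
  also have "\<dots> = real CARD('n) ^ ?n / fact ?n * dist a x ^ ?n * B"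
    by (simp add: power_mult_distrib)
  also have "\<dots> \<le> real CARD('n) ^ ?n / fact ?n * diameter S ^ ?n * B"
    by (intro mult_right_mono mult_left_mono power_mono B0 diameter_bounded_bound assms(2,3) \<open>x \<in> S\<close>) auto
  finally show ?thesis .
qed

text \<open>A nonempty open set in a space of positive dimension is not a singleton. This makes the
  constant of the estimate strictly positive.\<close>

lemma diameter_open_pos:
  fixes S :: "'a::euclidean_space set"
  assumes "open S" "bounded S" "a \<in> S"
  shows "0 < diameter S"
proof -
  obtain b where "b \<in> S" "b \<noteq> a"
    using assms not_open_singleton[of a] by (metis empty_iff insertI1 subsetI subset_singletonD singletonD)
  then show ?thesis
    using diameter_bounded_bound[OF assms(2,3) \<open>b \<in> S\<close>] by (metis order.strict_trans2 zero_less_dist_iff)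
qed

theorem theorem5p2p1:
  fixes m p :: nat
    and T :: "(real ^ 'n::finite) set"
    and x\<^sub>T :: "real ^ 'n"
    and \<alpha> :: "'n mindex \<Rightarrow> real ^ 'n \<Rightarrow> real"
    and u :: "real ^ 'n \<Rightarrow> real"
  assumes "mesh_element T"
    and "x\<^sub>T \<in> T"
    and "\<And>j. mi_abs j \<le> m \<Longrightarrow> C_class (nat (max (int p - int m) 0)) T (\<alpha> j)"
    and "C_class (p + 1) T u"
    and "\<And>x. x \<in> T \<Longrightarrow> diff_op m \<alpha> u x = 0"
  shows "taylor_poly (p + 1) x\<^sub>T u \<in> quasi_trefftz p m \<alpha> x\<^sub>T \<and>
    (star_shaped_wrt x\<^sub>T T \<longrightarrow>
      (\<forall>q\<le>p. (INF v\<in>quasi_trefftz p m \<alpha> x\<^sub>T. C_seminorm q T (\<lambda>x. u x - v x))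
         \<le> ennreal (real CARD('n) ^ (p + 1 - q) / fact (p + 1 - q) * diameter T ^ (p + 1 - q))
            * C_seminorm (p + 1) T u))"
proof -
  have T: "open T" "bounded T" using assms(1) by (auto simp: mesh_element_def)
  have C: "C_class (Suc p) T u" using assms(4) by simp
  have "nat (max (int p - int m) 0) = p - m" by auto
  then have QT: "taylor_poly (Suc p) x\<^sub>T u \<in> quasi_trefftz p m \<alpha> x\<^sub>T"
    using assms(3) by (intro taylor_poly_in_quasi_trefftz[OF T(1) assms(2) C _ assms(5)]) simp_all
  have "(INF v\<in>quasi_trefftz p m \<alpha> x\<^sub>T. C_seminorm q T (\<lambda>x. u x - v x))
      \<le> ennreal (real CARD('n) ^ (p + 1 - q) / fact (p + 1 - q) * diameter T ^ (p + 1 - q))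
          * C_seminorm (p + 1) T u" (is "_ \<le> ennreal ?K * _")
    if star: "star_shaped_wrt x\<^sub>T T" and q: "q \<le> p" for q
  proof (rule INF_lower2[OF QT])
    have K: "0 < ?K" using diameter_open_pos[OF T assms(2)] by simp
    show "C_seminorm q T (\<lambda>x. u x - taylor_poly (Suc p) x\<^sub>T u x) \<le> ennreal ?K * C_seminorm (p + 1) T u"
    \<comment> \<open>A finite seminorm is a real bound \<open>B\<close>. An infinite one makes the
      right-hand side \<open>top\<close>, by positivity of \<open>?K\<close>; in
      \<open>ennreal\<close>, \<open>0 * top\<close> would be 0.\<close>
    proof (cases "C_seminorm (p + 1) T u")
      case (real B)
      have B: "\<bar>mderiv j u y\<bar> \<le> B" if "mi_abs j = Suc p" "y \<in> T" for j y
        using that real C_seminorm_le_iff[of "p + 1" T u "ennreal B"] by auto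
      have "\<bar>mderiv i (\<lambda>x. u x - taylor_poly (Suc p) x\<^sub>T u x) x\<bar> \<le> ?K * B"
        if "mi_abs i = q" "x \<in> T" for i x
        using taylor_error_bound[OF T assms(2) _ C _ B, of x i] star q that
        by (simp add: star_shaped_wrt_def)
      then show ?thesis
        unfolding C_seminorm_le_iff using real K by (simp add: ennreal_mult[symmetric] ennreal_leI)
    next
      case top
      have "ennreal ?K * top = (top :: ennreal)" using K by (intro ennreal_top_mult_left) (simp only: ennreal_eq_0_iff not_le)
      then show ?thesis unfolding top by (simp only: top_greatest)
    qed
  qed
  with QT show ?thesis by simp
qed

end
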